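(* Let $(G,\oplus)$ be a normed gyrogroup with gyronorm metric $d$. Suppose that at least one of the following conditions holds: (I) (right-gyrotranslation inequality) $d(x\oplus a,y\oplus a)\le d(x,y)$ for all $a,x,y\in G$; (II) (Klee's condition) $d(x\oplus y,a\oplus b)\le d(x,a)+d(y,b)$ for all $a,b,x,y\in G$. Then $G$ is a topological gyrogroup with respect to the topology induced by the gyronorm metric.
   Context: A gyrogroup is a nonempty set $G$ with a binary operation $\oplus$ such that: (G1) there is an element $e\in G$ with $e\oplus a=a$ for all $a\in G$; (G2) for each $a\in G$ there is $b\in G$ with $b\oplus a=e$; (G3) for all $a,b\in G$ there is an automorphism $\mathrm{gyr}[a,b]$ of $(G,\oplus)$ (a bijection $G\to G$ preserving $\oplus$) such that $a\oplus(b\oplus c)=(a\oplus b)\oplus\mathrm{gyr}[a,b]c$ for all $c\in G$; (G4) $\mathrm{gyr}[a\oplus b,b]=\mathrm{gyr}[a,b]$ for all $a,b\in G$. Then $e$ is the unique two-sided identity and each $a$ has a unique two-sided inverse $\ominus a$; $\mathrm{gyr}[a,b]$ is called the gyroautomorphism generated by $a$ and $b$. A gyronorm on a gyrogroup $G$ is a function $\|\cdot\|\colon G\to\mathbb{R}$ such that: (1) $\|x\|\ge 0$ for all $x\in G$, and $\|x\|=0$ if and only if $x=e$; (2) $\|\ominus x\|=\|x\|$ for all $x\in G$; (3) $\|x\oplus y\|\le\|x\|+\|y\|$ for all $x,y\in G$; (4) $\|\mathrm{gyr}[a,b]x\|=\|x\|$ for all $a,b,x\in G$. A normed gyrogroup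 is a gyrogroup equipped with a gyronorm; its gyronorm metric is $d(x,y)=\|\ominus x\oplus y\|$. A gyrogroup $G$ endowed with a topology is a topological gyrogroup if (i) the map $G\times G\to G$, $(x,y)\mapsto x\oplus y$, is jointly continuous and (ii) the inversion map $G\to G$, $x\mapsto\ominus x$, is continuous. *)

theory Defs
  imports "HOL-Analysis.Analysis"
begin

text \<open>
  Gyrogroups are given on a carrier set. The identity and the gyroautomorphisms are locale
  parameters; both are determined (the latter on the carrier) by the carrier and the operation,
  so this is no extra structure. Equality of gyroautomorphisms means equality on the carrier.
\<close>

locale gyrogroup =
  fixes G :: "'a set"
    and add :: "'a \<Rightarrow> 'a \<Rightarrow> 'a" (infixl "\<oplus>" 65)
    and e :: 'a
    and gyr :: "'a \<Rightarrow> 'a \<Rightarrow> 'a \<Rightarrow> 'a"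
  assumes add_closed: "\<lbrakk>a \<in> G; b \<in> G\<rbrakk> \<Longrightarrow> a \<oplus> b \<in> G"
    and e_closed: "e \<in> G"
    and left_id: "a \<in> G \<Longrightarrow> e \<oplus> a = a"
    and left_inv_ex: "a \<in> G \<Longrightarrow> \<exists>b\<in>G. b \<oplus> a = e"
    and gyr_bij: "\<lbrakk>a \<in> G; b \<in> G\<rbrakk> \<Longrightarrow> bij_betw (gyr a b) G G"
    and gyr_hom: "\<lbrakk>a \<in> G; b \<in> G; x \<in> G; y \<in> G\<rbrakk> \<Longrightarrow> gyr a b (x \<oplus> y) = gyr a b x \<oplus> gyr a b y"
    and gyr_assoc: "\<lbrakk>a \<in> G; b \<in> G; c \<in> G\<rbrakk> \<Longrightarrow> a \<oplus> (b \<oplus> c) = (a \<oplus> b) \<oplus> gyr a b c"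
    and gyr_loop: "\<lbrakk>a \<in> G; b \<in> G; c \<in> G\<rbrakk> \<Longrightarrow> gyr (a \<oplus> b) b c = gyr a b c"
begin

definition gyroinv :: "'a \<Rightarrow> 'a" ("\<ominus> _" [81] 80)
  where "\<ominus> a = (THE b. b \<in> G \<and> b \<oplus> a = e \<and> a \<oplus> b = e)"

lemma gyr_closed: "\<lbrakk>a \<in> G; b \<in> G; c \<in> G\<rbrakk> \<Longrightarrow> gyr a b c \<in> G"
  using gyr_bij bij_betw_apply by metis

lemma left_cancel:
  assumes "a \<in> G" "b \<in> G" "c \<in> G" "a \<oplus> b = a \<oplus> c"
  shows "b = c"
proof -
  obtain a' where a': "a' \<in> G" "a' \<oplus> a = e" using left_inv_ex assms(1) by blast
  have "gyr a' a b = gyr a' a c"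
    using gyr_assoc[OF a'(1) assms(1)] a' assms left_id gyr_closed by metis
  then show ?thesis
    using gyr_bij[OF a'(1) assms(1)] assms unfolding bij_betw_def inj_on_def by blast
qed

lemma left_inv_cancel:
  assumes "a' \<in> G" "a \<in> G" "a' \<oplus> a = e" "b \<in> G"
  shows "a' \<oplus> (a \<oplus> b) = b"
proof -
  have "gyr e a b = b"
  proof (rule left_cancel[OF assms(2)])
    show "a \<oplus> gyr e a b = a \<oplus> b"
      using gyr_assoc[OF e_closed assms(2,4)] left_id add_closed assms by metis
  qed (use assms e_closed gyr_closed in auto)
  then have "gyr a' a b = b" using gyr_loop[OF assms(1,2,4)] assms(3) by simp
  then show ?thesis using gyr_assoc[OF assms(1,2,4)] assms left_id by simp
qed

lemma right_id: "a \<in> G \<Longrightarrow> a \<oplus> e = a"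
  by (metis left_inv_ex left_inv_cancel left_cancel e_closed add_closed)

lemma left_inv_right_inv: "\<lbrakk>a' \<in> G; a \<in> G; a' \<oplus> a = e\<rbrakk> \<Longrightarrow> a \<oplus> a' = e"
  by (metis left_inv_cancel left_cancel e_closed add_closed right_id)

lemma gyroinv_unique: "\<lbrakk>b \<in> G; a \<in> G; b \<oplus> a = e\<rbrakk> \<Longrightarrow> \<ominus> a = b"
  unfolding gyroinv_def
  by (rule the_equality) (metis left_inv_right_inv left_cancel)+

lemma gyroinv:
  assumes "a \<in> G"
  shows "\<ominus> a \<in> G" "\<ominus> a \<oplus> a = e" "a \<oplus> \<ominus> a = e"
  using left_inv_ex[OF assms] gyroinv_unique left_inv_right_inv assms by metis+

end

locale normed_gyrogroup = gyrogroup +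
  fixes gyronorm :: "'a \<Rightarrow> real" ("\<parallel>_\<parallel>")
  assumes gyronorm_nonneg: "x \<in> G \<Longrightarrow> 0 \<le> \<parallel>x\<parallel>"
    and gyronorm_eq_0_iff: "x \<in> G \<Longrightarrow> \<parallel>x\<parallel> = 0 \<longleftrightarrow> x = e"
    and gyronorm_inv: "x \<in> G \<Longrightarrow> \<parallel>\<ominus> x\<parallel> = \<parallel>x\<parallel>"
    and gyronorm_triangle: "\<lbrakk>x \<in> G; y \<in> G\<rbrakk> \<Longrightarrow> \<parallel>x \<oplus> y\<parallel> \<le> \<parallel>x\<parallel> + \<parallel>y\<parallel>"
    and gyronorm_gyr: "\<lbrakk>a \<in> G; b \<in> G; x \<in> G\<rbrakk> \<Longrightarrow> \<parallel>gyr a b x\<parallel> = \<parallel>x\<parallel>"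
begin

text \<open>
  The value 0 off the carrier is a dummy: the locale \<^locale>\<open>Metric_space\<close> requires
  nonnegativity and symmetry on the whole type, and its topology only sees values on the carrier.
\<close>

definition gyronorm_metric :: "'a \<Rightarrow> 'a \<Rightarrow> real"
  where "gyronorm_metric x y = (if x \<in> G \<and> y \<in> G then \<parallel>\<ominus> x \<oplus> y\<parallel> else 0)"

lemma Metric_space_gyronorm_metric: "Metric_space G gyronorm_metric"
proof
  show "0 \<le> gyronorm_metric x y" for x y
    by (simp add: gyronorm_metric_def gyronorm_nonneg add_closed gyroinv)
  show "gyronorm_metric x y = gyronorm_metric y x" for x y
  proof (cases "x \<in> G \<and> y \<in> G")
    case True
    let ?u = "\<ominus> x \<oplus> y" and ?v = "gyr (\<ominus> x) y (\<ominus> y \<oplus> x)"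
    have cl: "?u \<in> G" "?v \<in> G" "\<ominus> x \<in> G" "\<ominus> y \<in> G" "\<ominus> y \<oplus> x \<in> G"
      using True by (auto intro: add_closed gyroinv gyr_closed)
    have "?u \<oplus> ?v = \<ominus> x \<oplus> (y \<oplus> (\<ominus> y \<oplus> x))"
      using gyr_assoc[of "\<ominus> x" y "\<ominus> y \<oplus> x"] True cl by simp
    also have "\<dots> = e"
      using True cl left_inv_cancel[of y "\<ominus> y" x] gyroinv by simp
    finally have "\<ominus> ?v = ?u" using gyroinv_unique cl by blast
    then have "\<parallel>?u\<parallel> = \<parallel>\<ominus> y \<oplus> x\<parallel>"
      using gyronorm_inv[OF cl(2)] gyronorm_gyr True cl by simp
    with True show ?thesis by (simp add: gyronorm_metric_def)
  qed (auto simp: gyronorm_metric_def)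
  show "gyronorm_metric x y = 0 \<longleftrightarrow> x = y" if "x \<in> G" "y \<in> G" for x y
    using that left_cancel[of "\<ominus> x" y x]
    by (auto simp: gyronorm_metric_def gyronorm_eq_0_iff add_closed gyroinv)
  show "gyronorm_metric x z \<le> gyronorm_metric x y + gyronorm_metric y z"
    if "x \<in> G" "y \<in> G" "z \<in> G" for x y z
  proof -
    have cl: "\<ominus> x \<in> G" "\<ominus> y \<in> G" "\<ominus> y \<oplus> z \<in> G" "\<ominus> x \<oplus> y \<in> G"
      using that by (auto intro: add_closed gyroinv)
    have "\<ominus> x \<oplus> z = \<ominus> x \<oplus> (y \<oplus> (\<ominus> y \<oplus> z))"
      using that cl left_inv_cancel[of y "\<ominus> y" z] gyroinv by simp
    also have "\<dots> = (\<ominus> x \<oplus> y) \<oplus> gyr (\<ominus> x) y (\<ominus> y \<oplus> z)"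
      using gyr_assoc[of "\<ominus> x" y "\<ominus> y \<oplus> z"] that cl by simp
    finally have "\<parallel>\<ominus> x \<oplus> z\<parallel> \<le> \<parallel>\<ominus> x \<oplus> y\<parallel> + \<parallel>gyr (\<ominus> x) y (\<ominus> y \<oplus> z)\<parallel>"
      using gyronorm_triangle gyr_closed that cl by simp
    then show ?thesis
      using that cl by (simp add: gyronorm_metric_def gyronorm_gyr)
  qed
qed

end

locale topological_gyrogroup = gyrogroup +
  fixes T :: "'a topology"
  assumes topspace_eq: "topspace T = G"
    and continuous_add: "continuous_map (prod_topology T T) T (\<lambda>(x, y). x \<oplus> y)"
    and continuous_inv: "continuous_map T T (\<lambda>x. \<ominus> x)"

end

theory Submission
  imports Defs
begin

text \<open>
  Left gyrotranslations are isometries, because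
  \<open>\<ominus>(a \<oplus> x) \<oplus> (a \<oplus> y) = gyr[a,x](\<ominus>x \<oplus> y)\<close>. Hence (I) and (II) are equivalent,
  (II) says that addition is continuous, and together with right translations being
  nonexpansive it gives
  \<open>d(\<ominus>x, \<ominus>y) = d(x \<oplus> \<ominus>x, x \<oplus> \<ominus>y) = d(y \<oplus> \<ominus>y, x \<oplus> \<ominus>y) \<le> d(y, x)\<close>.
\<close>

context normed_gyrogroup
begin

interpretation Metric_space G gyronorm_metric
  by (rule Metric_space_gyronorm_metric)

lemma add_inv_cancel_left: "\<lbrakk>a \<in> G; b \<in> G\<rbrakk> \<Longrightarrow> a \<oplus> (\<ominus> a \<oplus> b) = b"
  using left_inv_cancel[of a "\<ominus> a" b] gyroinv by simp

lemma inv_add_cancel_left: "\<lbrakk>a \<in> G; b \<in> G\<rbrakk> \<Longrightarrow> \<ominus> a \<oplus> (a \<oplus> b) = b"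
  using left_inv_cancel[of "\<ominus> a" a b] gyroinv by simp

text \<open>Left gyroassociativity applied to \<open>y = x \<oplus> (\<ominus> x \<oplus> y)\<close>
  exhibits \<open>a \<oplus> y\<close> as \<open>a \<oplus> x\<close> plus a gyrated difference;
  cancelling \<open>a \<oplus> x\<close> on the left leaves that difference. Since
  \<open>gyr a x\<close> preserves the norm, left translations are isometries.\<close>

lemma inv_add_add_left:
  assumes "a \<in> G" "x \<in> G" "y \<in> G"
  shows "\<ominus> (a \<oplus> x) \<oplus> (a \<oplus> y) = gyr a x (\<ominus> x \<oplus> y)"
proof -
  have cl: "a \<oplus> x \<in> G" "\<ominus> x \<oplus> y \<in> G"
    using assms by (auto intro: add_closed gyroinv)
  have "a \<oplus> y = a \<oplus> (x \<oplus> (\<ominus> x \<oplus> y))"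
    using assms by (simp add: add_inv_cancel_left)
  also have "\<dots> = (a \<oplus> x) \<oplus> gyr a x (\<ominus> x \<oplus> y)"
    using gyr_assoc assms cl by blast
  finally show ?thesis
    using inv_add_cancel_left assms cl gyr_closed by simp
qed

lemma gyronorm_metric_add_left:
  assumes "a \<in> G" "x \<in> G" "y \<in> G"
  shows "gyronorm_metric (a \<oplus> x) (a \<oplus> y) = gyronorm_metric x y"
  using assms
  by (simp add: gyronorm_metric_def inv_add_add_left gyronorm_gyr add_closed gyroinv)

lemma right_nonexpansive_iff_klee:
  "(\<forall>a\<in>G. \<forall>x\<in>G. \<forall>y\<in>G. gyronorm_metric (x \<oplus> a) (y \<oplus> a) \<le> gyronorm_metric x y) \<longleftrightarrow>
   (\<forall>a\<in>G. \<forall>b\<in>G. \<forall>x\<in>G. \<forall>y\<in>G.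
      gyronorm_metric (x \<oplus> y) (a \<oplus> b) \<le> gyronorm_metric x a + gyronorm_metric y b)"
  (is "?I \<longleftrightarrow> ?II")
proof
  assume I: ?I
  have "gyronorm_metric (x \<oplus> y) (a \<oplus> b) \<le> gyronorm_metric x a + gyronorm_metric y b"
    if "a \<in> G" "b \<in> G" "x \<in> G" "y \<in> G" for a b x y
  proof -
    \<comment> \<open>The intermediate point \<open>a \<oplus> y\<close> splits the change into a
      right translation by \<open>y\<close>, bounded by (I), and a left translation by
      \<open>a\<close>, which is an isometry.\<close>
    have "gyronorm_metric (x \<oplus> y) (a \<oplus> b)
        \<le> gyronorm_metric (x \<oplus> y) (a \<oplus> y) + gyronorm_metric (a \<oplus> y) (a \<oplus> b)"
      using that by (intro triangle add_closed)
    also have "\<dots> \<le> gyronorm_metric x a + gyronorm_metric y b"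
      using I that by (intro add_mono) (simp_all add: gyronorm_metric_add_left)
    finally show ?thesis .
  qed
  then show ?II by blast
next
  assume II: ?II
  have "gyronorm_metric (x \<oplus> a) (y \<oplus> a) \<le> gyronorm_metric x y"
    if "a \<in> G" "x \<in> G" "y \<in> G" for a x y
    \<comment> \<open>With the same right summand \<open>a\<close> on both sides, the second
      distance in Klee's bound is \<open>d(a, a) = 0\<close>.\<close>
    using II[rule_format, of y a x a] that by (simp add: mdist_zero)
  then show ?I by blast
qed

lemma gyronorm_metric_inv_le:
  assumes I: "\<forall>a\<in>G. \<forall>x\<in>G. \<forall>y\<in>G. gyronorm_metric (x \<oplus> a) (y \<oplus> a) \<le> gyronorm_metric x y"
    and "x \<in> G" "y \<in> G"
  shows "gyronorm_metric (\<ominus> x) (\<ominus> y) \<le> gyronorm_metric x y"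
proof -
  have "gyronorm_metric (\<ominus> x) (\<ominus> y) = gyronorm_metric (x \<oplus> \<ominus> x) (x \<oplus> \<ominus> y)"
    using assms gyronorm_metric_add_left gyroinv(1) by simp
  \<comment> \<open>Both \<open>x \<oplus> \<ominus> x\<close> and
    \<open>y \<oplus> \<ominus> y\<close> equal \<open>e\<close>. After the exchange the two points
    are the right translates of \<open>y\<close> and \<open>x\<close> by \<open>\<ominus> y\<close>,
    so (I) applies.\<close>
  also have "\<dots> = gyronorm_metric (y \<oplus> \<ominus> y) (x \<oplus> \<ominus> y)"
    using assms by (simp add: gyroinv)
  also have "\<dots> \<le> gyronorm_metric y x"
    using assms gyroinv by blast
  finally show ?thesis by (simp add: commute)
qed

text \<open>Klee's condition makes addition 1-Lipschitz for the sum of the coordinate distances, so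
  a product of two balls of radius \<open>\<epsilon> / 2\<close> is mapped into the
  \<open>\<epsilon>\<close>-ball around the image.\<close>

lemma continuous_map_add_if_klee:
  assumes II: "\<forall>a\<in>G. \<forall>b\<in>G. \<forall>x\<in>G. \<forall>y\<in>G.
      gyronorm_metric (x \<oplus> y) (a \<oplus> b) \<le> gyronorm_metric x a + gyronorm_metric y b"
  shows "continuous_map (prod_topology mtopology mtopology) mtopology (\<lambda>(x, y). x \<oplus> y)"
  unfolding continuous_map_to_metric
proof (intro ballI allI impI)
  fix p and \<epsilon> :: real
  assume p: "p \<in> topspace (prod_topology mtopology mtopology)" and \<epsilon>: "\<epsilon> > 0"
  obtain x y where xy: "p = (x, y)" "x \<in> G" "y \<in> G"
    using p by auto
  let ?U = "mball x (\<epsilon> / 2) \<times> mball y (\<epsilon> / 2)"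
  have "x \<oplus> y \<in> G \<and> a \<oplus> b \<in> G \<and> gyronorm_metric (x \<oplus> y) (a \<oplus> b) < \<epsilon>"
    if "a \<in> mball x (\<epsilon> / 2)" "b \<in> mball y (\<epsilon> / 2)" for a b
    using II[rule_format, of a b x y] that by (auto simp: add_closed)
  then have "\<forall>q\<in>?U. (case q of (x, y) \<Rightarrow> x \<oplus> y) \<in> mball (case p of (x, y) \<Rightarrow> x \<oplus> y) \<epsilon>"
    using xy by auto
  moreover have "openin (prod_topology mtopology mtopology) ?U" "p \<in> ?U"
    using xy \<epsilon> by (auto simp: openin_prod_Times_iff)
  ultimately show "\<exists>U. openin (prod_topology mtopology mtopology) U \<and> p \<in> U \<and>
      (\<forall>q\<in>U. (case q of (x, y) \<Rightarrow> x \<oplus> y) \<in> mball (case p of (x, y) \<Rightarrow> x \<oplus> y) \<epsilon>)"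
    by blast
qed

lemma continuous_map_inv_if_right_nonexpansive:
  assumes I: "\<forall>a\<in>G. \<forall>x\<in>G. \<forall>y\<in>G. gyronorm_metric (x \<oplus> a) (y \<oplus> a) \<le> gyronorm_metric x y"
  shows "continuous_map mtopology mtopology (\<lambda>x. \<ominus> x)"
  unfolding continuous_map_to_metric
proof (intro ballI allI impI)
  fix x and \<epsilon> :: real
  assume x: "x \<in> topspace mtopology" and \<epsilon>: "\<epsilon> > 0"
  \<comment> \<open>Inversion is nonexpansive, so the same radius serves in the domain and in the
    codomain.\<close>
  have "\<ominus> y \<in> mball (\<ominus> x) \<epsilon>" if "y \<in> mball x \<epsilon>" for y
    using that gyronorm_metric_inv_le[OF I, of x y] by (auto simp: gyroinv)
  then show "\<exists>U. openin mtopology U \<and> x \<in> U \<and> (\<forall>y\<in>U. \<ominus> y \<in> mball (\<ominus> x) \<epsilon>)"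
    using x \<epsilon> by (intro exI[of _ "mball x \<epsilon>"]) auto
qed

lemma topological_gyrogroup_if_klee:
  assumes II: "\<forall>a\<in>G. \<forall>b\<in>G. \<forall>x\<in>G. \<forall>y\<in>G.
      gyronorm_metric (x \<oplus> y) (a \<oplus> b) \<le> gyronorm_metric x a + gyronorm_metric y b"
  shows "topological_gyrogroup G (\<oplus>) e gyr mtopology"
  using continuous_map_add_if_klee[OF II]
    continuous_map_inv_if_right_nonexpansive[OF right_nonexpansive_iff_klee[THEN iffD2, OF II]]
  by unfold_locales simp_all

end

theorem theorem4p11:
  fixes G :: "'a set"
    and add :: "'a \<Rightarrow> 'a \<Rightarrow> 'a" (infixl "\<oplus>" 65)
    and e :: 'a
    and gyr :: "'a \<Rightarrow> 'a \<Rightarrow> 'a \<Rightarrow> 'a"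
    and gyronorm :: "'a \<Rightarrow> real"
    and d :: "'a \<Rightarrow> 'a \<Rightarrow> real"
  assumes "normed_gyrogroup G (\<oplus>) e gyr gyronorm"
    and "d = normed_gyrogroup.gyronorm_metric G (\<oplus>) e gyronorm"
    and "(\<forall>a\<in>G. \<forall>x\<in>G. \<forall>y\<in>G. d (x \<oplus> a) (y \<oplus> a) \<le> d x y) \<or>
         (\<forall>a\<in>G. \<forall>b\<in>G. \<forall>x\<in>G. \<forall>y\<in>G. d (x \<oplus> y) (a \<oplus> b) \<le> d x a + d y b)"
  shows "topological_gyrogroup G (\<oplus>) e gyr (Metric_space.mtopology G d)"
proof -
  interpret normed_gyrogroup G "(\<oplus>)" e gyr gyronorm by (rule assms(1))
  show ?thesis
    \<comment> \<open>The equivalence turns case (I) into case (II), so a single result settles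
      both.\<close>
    using assms(3) right_nonexpansive_iff_klee topological_gyrogroup_if_klee
    unfolding assms(2) by blast
qed

end
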